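(* Let $G$ be a simple graph, let $S_1$ be a $k$-simplicial set of $G$, let $S_1,\ldots,S_r$ be the parts of the complete multipartite graph $G_{N_G[S_1]}$, and let $G'_i=G\setminus N_G[S_i]$ for $i=1,\ldots,r$. Then $G$ is $k$-shellable if and only if $G'_i$ is $k$-shellable for all $i=1,\ldots,r$.
   Context: $N_G(x)$ is the set of neighbours of $x$, $N_G[x]=N_G(x)\cup\{x\}$, $N_G[U]=\bigcup_{x\in U}N_G[x]$; $G\setminus U$ deletes the vertices of $U$ and incident edges; $G_U$ is the induced subgraph on $U$. A set $S$ of pairwise non-adjacent vertices of $G$ is a $k$-simplicial set if $G_{N_G[S]}$ is a complete $r$-partite graph with $k$-element parts $S_1,\ldots,S_r$ such that for every part $S_l$ and every two vertices $x_i,x_j\in S_l$, $N_G(x_i)=N_G(x_j)$. A graph $H$ is $k$-shellable if its independence complex $\Delta_H$ (faces: sets of pairwise non-adjacent vertices) is. $\langle F_1,\ldots,F_s\rangle$ denotes the complex with facets $F_1,\dots,F_s$. A complex $\Gamma$ of dimension $d$ is $k$-shellable ($1\le k\le d+1$) if its facets can be ordered $F_1,\ldots,F_r$ such that for every $j=2,\ldots,r$, $\Gamma_j=\langle F_j\rangle\cap\langle F_1,\ldots,F_{j-1}\rangle$ satisfies (i) $\Gamma_j$ is generated by a nonempty set of faces of $\langle F_j\rangle$ of dimension $|F_j|-k-1$; (ii) if $\Gamma_j$ has more than one facet, then for every two distinct facets $\sigma,\tau$ of $\Gamma_j$, $F_j\subseteq\sigma\cup\tau$.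
   Formalization: The bound k ≤ d+1 in the definition of k-shellable is dropped (only k ≥ 1 is kept); with it the claim fails for G = K_{k,k}, which is k-shellable while each G'_i is the empty graph, whose complex has dimension −1. *)

theory Defs
  imports Main
begin

definition simple_graph :: "'a set \<Rightarrow> ('a \<Rightarrow> 'a \<Rightarrow> bool) \<Rightarrow> bool" where
  "simple_graph V E \<longleftrightarrow> finite V \<and> (\<forall>x y. E x y \<longrightarrow> E y x) \<and> (\<forall>x. \<not> E x x)
     \<and> (\<forall>x y. E x y \<longrightarrow> x \<in> V \<and> y \<in> V)"

definition nbhd :: "'a set \<Rightarrow> ('a \<Rightarrow> 'a \<Rightarrow> bool) \<Rightarrow> 'a \<Rightarrow> 'a set" where
  "nbhd V E x = {y \<in> V. E x y}"

definition closed_nbhd :: "'a set \<Rightarrow> ('a \<Rightarrow> 'a \<Rightarrow> bool) \<Rightarrow> 'a \<Rightarrow> 'a set" where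
  "closed_nbhd V E x = insert x (nbhd V E x)"

definition closed_nbhd_set :: "'a set \<Rightarrow> ('a \<Rightarrow> 'a \<Rightarrow> bool) \<Rightarrow> 'a set \<Rightarrow> 'a set" where
  "closed_nbhd_set V E U = (\<Union>x\<in>U. closed_nbhd V E x)"

definition restrict_edges :: "('a \<Rightarrow> 'a \<Rightarrow> bool) \<Rightarrow> 'a set \<Rightarrow> 'a \<Rightarrow> 'a \<Rightarrow> bool" where
  "restrict_edges E U = (\<lambda>x y. E x y \<and> x \<in> U \<and> y \<in> U)"

definition independent :: "'a set \<Rightarrow> ('a \<Rightarrow> 'a \<Rightarrow> bool) \<Rightarrow> 'a set \<Rightarrow> bool" where
  "independent V E S \<longleftrightarrow> S \<subseteq> V \<and> (\<forall>x\<in>S. \<forall>y\<in>S. \<not> E x y)"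

definition indep_complex :: "'a set \<Rightarrow> ('a \<Rightarrow> 'a \<Rightarrow> bool) \<Rightarrow> 'a set set" where
  "indep_complex V E = {F. independent V E F}"

definition complete_multipartite :: "'a set \<Rightarrow> ('a \<Rightarrow> 'a \<Rightarrow> bool) \<Rightarrow> 'a set set \<Rightarrow> bool" where
  "complete_multipartite W E P \<longleftrightarrow>
     \<Union>P = W \<and> {} \<notin> P \<and> (\<forall>p\<in>P. \<forall>q\<in>P. p \<noteq> q \<longrightarrow> p \<inter> q = {})
     \<and> (\<forall>x\<in>W. \<forall>y\<in>W. E x y \<longleftrightarrow> \<not> (\<exists>p\<in>P. x \<in> p \<and> y \<in> p))"

definition k_simplicial :: "'a set \<Rightarrow> ('a \<Rightarrow> 'a \<Rightarrow> bool) \<Rightarrow> nat \<Rightarrow> 'a set \<Rightarrow> 'a set set \<Rightarrow> bool" where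
  "k_simplicial V E k S P \<longleftrightarrow>
     independent V E S
     \<and> complete_multipartite (closed_nbhd_set V E S)
          (restrict_edges E (closed_nbhd_set V E S)) P
     \<and> (\<forall>p\<in>P. card p = k)
     \<and> (\<forall>p\<in>P. \<forall>x\<in>p. \<forall>y\<in>p. nbhd V E x = nbhd V E y)"

definition facets :: "'a set set \<Rightarrow> 'a set set" where
  "facets \<Gamma> = {F \<in> \<Gamma>. \<forall>G\<in>\<Gamma>. F \<subseteq> G \<longrightarrow> G = F}"

definition generated :: "'a set set \<Rightarrow> 'a set set" where
  "generated A = {\<sigma>. \<exists>a\<in>A. \<sigma> \<subseteq> a}"

text \<open>k-shellability of a (finite) simplicial complex: an ordering F_1..F_r of its facets
  such that for j \<ge> 2, \<Gamma>_j = <F_j> \<inter> <F_1,...,F_{j-1}> satisfies (i) and (ii).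
  Faces of dimension |F_j|-k-1 are faces of cardinality |F_j|-k.\<close>
definition k_shellable :: "nat \<Rightarrow> 'a set set \<Rightarrow> bool" where
  "k_shellable k \<Gamma> \<longleftrightarrow> 1 \<le> k \<and>
     (\<exists>Fs. distinct Fs \<and> set Fs = facets \<Gamma> \<and>
       (\<forall>j. 0 < j \<and> j < length Fs \<longrightarrow>
          (let Gj = generated {Fs ! j} \<inter> generated {Fs ! i | i. i < j} in
             (\<exists>A. A \<noteq> {} \<and> A \<subseteq> generated {Fs ! j}
                  \<and> (\<forall>a\<in>A. card a + k = card (Fs ! j)) \<and> Gj = generated A)
           \<and> (card (facets Gj) > 1 \<longrightarrow>
                (\<forall>\<sigma>\<in>facets Gj. \<forall>\<tau>\<in>facets Gj. \<sigma> \<noteq> \<tau> \<longrightarrow> Fs ! j \<subseteq> \<sigma> \<union> \<tau>)))))"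

definition k_shellable_graph :: "'a set \<Rightarrow> ('a \<Rightarrow> 'a \<Rightarrow> bool) \<Rightarrow> nat \<Rightarrow> bool" where
  "k_shellable_graph V E k \<longleftrightarrow> k_shellable k (indep_complex V E)"

end

theory Submission
  imports Defs
begin

text \<open>In a \<open>k\<close>-shelling, the complements \<open>F\<^sub>j - \<sigma>\<close> of the facets \<open>\<sigma>\<close> of \<open>\<Gamma>\<^sub>j\<close> are pairwise disjoint
  \<open>k\<close>-sets, namely the minimal ones among the differences \<open>F\<^sub>j - F\<^sub>i\<close> with \<open>i < j\<close>.  In this form it is
  clear that a shelling restricts to the facets containing a given face, i.e. to its link, and
  the complex of \<open>G'\<^sub>i\<close> is the link of \<open>S\<^sub>i\<close>.

  Conversely, every maximal independent set contains exactly one part \<open>S\<^sub>i\<close>.  Concatenate the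
  shellings of the links, starting with that of \<open>S\<^sub>1\<close>.  For \<open>i \<ge> 2\<close>, a facet \<open>F\<close> containing \<open>S\<^sub>i\<close>
  meets the facets of earlier blocks outside \<open>S\<^sub>i\<close>, and \<open>(F - S\<^sub>i) \<union> S\<^sub>1\<close> is independent because all
  neighbours of \<open>S\<^sub>1\<close> lie in the parts; so some facet \<open>H\<close> of the first block has \<open>F - H = S\<^sub>i\<close>, and
  \<open>S\<^sub>i\<close> is the only new minimal difference.\<close>

section \<open>Shellings via set differences\<close>

text \<open>\<open>\<B>\<close> collects the complements in \<open>F\<close> of the facets of the
  intersection complex. Demanding that its members occur among the differences \<open>F - G\<close>
  puts these facets inside earlier facets, and pairwise disjointness is condition (ii):
  \<open>F\<close> is covered by the union of two faces iff their complements in \<open>F\<close>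
  are disjoint.\<close>

definition attachable :: "nat \<Rightarrow> 'a set set \<Rightarrow> 'a set \<Rightarrow> bool" where
  "attachable k \<F> F \<longleftrightarrow> (\<exists>\<B> \<subseteq> (-) F ` \<F>. (\<forall>B\<in>\<B>. card B = k) \<and> pairwise disjnt \<B>
     \<and> (\<forall>G\<in>\<F>. \<exists>B\<in>\<B>. B \<subseteq> F - G))"

text \<open>\<open>\<F>\<close> holds the facets placed so far. Allowing it to start nonempty lets a
  block of facets be attached to an existing complex.\<close>

fun shelling :: "nat \<Rightarrow> 'a set set \<Rightarrow> 'a set list \<Rightarrow> bool" where
  "shelling k \<F> [] \<longleftrightarrow> True"
| "shelling k \<F> (F # Fs) \<longleftrightarrow> attachable k \<F> F \<and> shelling k (insert F \<F>) Fs"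

lemma attachable_empty [simp]: "attachable k {} F"
  by (simp add: attachable_def)

lemma shelling_append:
  "shelling k \<F> (Fs @ Gs) \<longleftrightarrow> shelling k \<F> Fs \<and> shelling k (\<F> \<union> set Fs) Gs"
  by (induction Fs arbitrary: \<F>) auto

lemma shelling_iff_nth:
  "shelling k \<F> Fs \<longleftrightarrow> (\<forall>j<length Fs. attachable k (\<F> \<union> set (take j Fs)) (Fs ! j))"
  by (induction Fs arbitrary: \<F>) (auto simp: All_less_Suc2)

section \<open>Agreement with the definition by generated complexes\<close>

lemma facets_generated_subset: "facets (generated A) \<subseteq> A"
  by (auto simp: facets_def generated_def)

text \<open>Finite sets of one cardinality form an antichain, so every generator is maximal.\<close>

lemma facets_generated_uniform:
  assumes "\<forall>a\<in>A. finite a \<and> card a = n"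
  shows "facets (generated A) = A"
proof
  show "A \<subseteq> facets (generated A)"
  proof
    fix a assume a: "a \<in> A"
    have "b = a" if "b \<subseteq> c" "c \<in> A" "a \<subseteq> b" for b c
    proof -
      have "a = c" using assms that a by (intro card_subset_eq) auto
      then show ?thesis using that by blast
    qed
    then show "a \<in> facets (generated A)" using a by (auto simp: facets_def generated_def)
  qed
qed (rule facets_generated_subset)

text \<open>Complementation in \<open>F\<close> exchanges the generators \<open>A\<close> with the
  family \<open>\<B>\<close>: size \<open>card F - k\<close> becomes size \<open>k\<close>, and
  covering \<open>F\<close> becomes disjointness. Nonemptiness of \<open>\<F>\<close> is what makes
  \<open>A\<close> nonempty.\<close>

lemma attachable_iff_generated:
  fixes F :: "'a set"
  assumes F: "finite F" and ne: "\<F> \<noteq> {}"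
  defines "\<Gamma> \<equiv> generated {F} \<inter> generated \<F>"
  shows "attachable k \<F> F \<longleftrightarrow>
    (\<exists>A. A \<noteq> {} \<and> A \<subseteq> generated {F} \<and> (\<forall>a\<in>A. card a + k = card F) \<and> \<Gamma> = generated A)
    \<and> (card (facets \<Gamma>) > 1 \<longrightarrow> (\<forall>\<sigma>\<in>facets \<Gamma>. \<forall>\<tau>\<in>facets \<Gamma>. \<sigma> \<noteq> \<tau> \<longrightarrow> F \<subseteq> \<sigma> \<union> \<tau>))"
    (is "_ \<longleftrightarrow> ?generated \<and> ?cover")
proof
  assume "attachable k \<F> F"
  then obtain \<B> where \<B>: "\<B> \<subseteq> (-) F ` \<F>" "\<forall>B\<in>\<B>. card B = k" "pairwise disjnt \<B>"
    "\<forall>G\<in>\<F>. \<exists>B\<in>\<B>. B \<subseteq> F - G"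
    unfolding attachable_def by blast
  define A where "A = (-) F ` \<B>"
  have sub: "B \<subseteq> F" if "B \<in> \<B>" for B using \<B>(1) that by blast
  have A_ne: "A \<noteq> {}" using \<B>(4) ne by (auto simp: A_def)
  have A_sub: "A \<subseteq> generated {F}" by (auto simp: A_def generated_def)
  have A_card: "\<forall>a\<in>A. card a + k = card F"
  proof
    fix a assume "a \<in> A"
    then obtain B where B: "B \<in> \<B>" "a = F - B" by (auto simp: A_def)
    then have "card a = card F - k" "k \<le> card F"
      using F \<B>(2) sub[OF B(1)] by (auto simp: card_Diff_subset finite_subset dest: card_mono[rotated])
    then show "card a + k = card F" by simp
  qed
  have gen: "\<Gamma> = generated A"
  proof
    show "\<Gamma> \<subseteq> generated A"
    proof
      fix \<sigma> assume "\<sigma> \<in> \<Gamma>"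
      then obtain G where "\<sigma> \<subseteq> F" "G \<in> \<F>" "\<sigma> \<subseteq> G" by (auto simp: \<Gamma>_def generated_def)
      moreover obtain B where "B \<in> \<B>" "B \<subseteq> F - G" using \<B>(4) \<open>G \<in> \<F>\<close> by blast
      ultimately show "\<sigma> \<in> generated A" by (auto simp: A_def generated_def)
    qed
    show "generated A \<subseteq> \<Gamma>"
    proof
      fix \<sigma> assume "\<sigma> \<in> generated A"
      then obtain B where "B \<in> \<B>" "\<sigma> \<subseteq> F - B" by (auto simp: A_def generated_def)
      moreover obtain G where "G \<in> \<F>" "B = F - G" using \<B>(1) \<open>B \<in> \<B>\<close> by blast
      ultimately show "\<sigma> \<in> \<Gamma>" by (auto simp: \<Gamma>_def generated_def)
    qed
  qed
  have ?cover
  proof (intro impI ballI)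
    fix \<sigma> \<tau> assume "\<sigma> \<in> facets \<Gamma>" "\<tau> \<in> facets \<Gamma>" "\<sigma> \<noteq> \<tau>"
    then have "\<sigma> \<in> A" "\<tau> \<in> A" using facets_generated_subset[of A] by (auto simp only: gen)
    then obtain B C where "B \<in> \<B>" "\<sigma> = F - B" "C \<in> \<B>" "\<tau> = F - C"
      by (auto simp only: A_def)
    moreover from this have "disjnt B C"
      using \<B>(3) \<open>\<sigma> \<noteq> \<tau>\<close> by (metis pairwise_def)
    ultimately show "F \<subseteq> \<sigma> \<union> \<tau>" by (auto simp: disjnt_def)
  qed
  moreover have ?generated
    by (intro exI[of _ A] conjI A_ne A_sub A_card gen)
  ultimately show "?generated \<and> ?cover" by (rule conjI[rotated])
next
  assume R: "?generated \<and> ?cover"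
  then obtain A where A: "A \<noteq> {}" "A \<subseteq> generated {F}" "\<forall>a\<in>A. card a + k = card F" "\<Gamma> = generated A"
    by (elim conjE exE) (rule that)
  have sub: "a \<subseteq> F" "finite a" "card a = card F - k" if "a \<in> A" for a
    using A(2,3) that F by (auto simp: generated_def finite_subset)
  have fac: "facets \<Gamma> = A"
    unfolding A(4) by (rule facets_generated_uniform) (auto simp: sub)
  \<comment> \<open>Needed for the premise \<open>card (facets \<Gamma>) > 1\<close> of condition
    (ii), since \<open>card\<close> is 0 on infinite sets.\<close>
  have finA: "finite A"
    by (rule finite_subset[of _ "Pow F"]) (use sub(1) F in auto)
  have cover: "F \<subseteq> a \<union> b" if "a \<in> A" "b \<in> A" "a \<noteq> b" for a b
  proof -
    have "card {a, b} \<le> card A" using that finA by (intro card_mono) auto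
    then have "card (facets \<Gamma>) > 1" using that fac by simp
    then show ?thesis using conjunct2[OF R, THEN mp] that unfolding fac by blast
  qed
  have above: "\<exists>a\<in>A. F \<inter> G \<subseteq> a" if "G \<in> \<F>" for G
  proof -
    have "F \<inter> G \<in> \<Gamma>" using that by (auto simp: \<Gamma>_def generated_def)
    then show ?thesis by (auto simp: A(4) generated_def)
  qed
  \<comment> \<open>A generator \<open>a\<close> lies in some \<open>F \<inter> G\<close>, which
    lies in some generator \<open>b\<close>. As \<open>a\<close> and \<open>b\<close> have equal
    size, all three coincide, so \<open>F - a\<close> is the difference
    \<open>F - G\<close>.\<close>
  have exact: "\<exists>G\<in>\<F>. a = F \<inter> G" if "a \<in> A" for a
  proof -
    have "a \<in> \<Gamma>" using that by (auto simp: A(4) generated_def)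
    then obtain G where G: "G \<in> \<F>" "a \<subseteq> F \<inter> G" by (auto simp: \<Gamma>_def generated_def)
    obtain b where b: "b \<in> A" "F \<inter> G \<subseteq> b" using above[OF G(1)] by blast
    have "a = b" using sub[OF that] sub[OF b(1)] G b by (intro card_subset_eq) auto
    then show ?thesis using G b by blast
  qed
  show "attachable k \<F> F"
    unfolding attachable_def
  proof (intro exI[of _ "(-) F ` A"] conjI)
    show "(-) F ` A \<subseteq> (-) F ` \<F>" using exact by blast
    show "\<forall>B\<in>(-) F ` A. card B = k"
    proof safe
      fix a assume "a \<in> A"
      then show "card (F - a) = k" using sub[of a] A(3) by (auto simp: card_Diff_subset)
    qed
    show "pairwise disjnt ((-) F ` A)"
      unfolding pairwise_def disjnt_def using cover by blast
    show "\<forall>G\<in>\<F>. \<exists>B\<in>(-) F ` A. B \<subseteq> F - G"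
    proof
      fix G assume "G \<in> \<F>"
      then obtain a where "a \<in> A" "F \<inter> G \<subseteq> a" using above by blast
      then have "F - a \<in> (-) F ` A" "F - a \<subseteq> F - G" by auto
      then show "\<exists>B\<in>(-) F ` A. B \<subseteq> F - G" by (rule bexI[rotated])
    qed
  qed
qed

lemma k_shellable_iff_shelling:
  assumes fin: "\<And>F. F \<in> \<Gamma> \<Longrightarrow> finite F"
  shows "k_shellable k \<Gamma> \<longleftrightarrow>
    1 \<le> k \<and> (\<exists>Fs. distinct Fs \<and> set Fs = facets \<Gamma> \<and> shelling k {} Fs)"
proof -
  have "shelling k {} Fs \<longleftrightarrow> (\<forall>j. 0 < j \<and> j < length Fs \<longrightarrow>
          (let Gj = generated {Fs ! j} \<inter> generated {Fs ! i | i. i < j} in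
             (\<exists>A. A \<noteq> {} \<and> A \<subseteq> generated {Fs ! j}
                  \<and> (\<forall>a\<in>A. card a + k = card (Fs ! j)) \<and> Gj = generated A)
           \<and> (card (facets Gj) > 1 \<longrightarrow>
                (\<forall>\<sigma>\<in>facets Gj. \<forall>\<tau>\<in>facets Gj. \<sigma> \<noteq> \<tau> \<longrightarrow> Fs ! j \<subseteq> \<sigma> \<union> \<tau>))))"
    (is "_ \<longleftrightarrow> (\<forall>j. 0 < j \<and> j < length Fs \<longrightarrow> ?step j)")
    if Fs: "set Fs = facets \<Gamma>" for Fs
  proof -
    have "attachable k (set (take j Fs)) (Fs ! j) \<longleftrightarrow> ?step j" if "0 < j" "j < length Fs" for j
    proof -
      have prev: "{Fs ! i | i. i < j} = set (take j Fs)"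
        using that by (auto simp: nth_image[symmetric])
      have "Fs ! j \<in> \<Gamma>" using Fs that nth_mem[of j Fs] by (auto simp: facets_def)
      moreover have "set (take j Fs) \<noteq> {}" using that by auto
      ultimately show ?thesis
        unfolding prev Let_def by (rule attachable_iff_generated[OF fin])
    qed
    moreover have "shelling k {} Fs \<longleftrightarrow>
        (\<forall>j. 0 < j \<and> j < length Fs \<longrightarrow> attachable k (set (take j Fs)) (Fs ! j))"
      \<comment> \<open>The index 0 imposes nothing, because no facet precedes it.\<close>
      by (auto simp: shelling_iff_nth) (metis attachable_empty gr0I list.set(1) take0)
    ultimately show ?thesis by (simp only: cong: imp_cong)
  qed
  then show ?thesis
    unfolding k_shellable_def by (simp only: cong: conj_cong)
qed

section \<open>Links\<close>

definition link :: "'a set set \<Rightarrow> 'a set \<Rightarrow> 'a set set" where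
  "link \<Gamma> T = {F. F \<inter> T = {} \<and> F \<union> T \<in> \<Gamma>}"

text \<open>Adding and removing \<open>T\<close> are mutually inverse, inclusion-preserving maps
  between the faces of the link and the faces of \<open>\<Gamma>\<close> containing
  \<open>T\<close>, so maximality transfers both ways.\<close>

lemma facets_link: "facets (link \<Gamma> T) = (\<lambda>F. F - T) ` {F \<in> facets \<Gamma>. T \<subseteq> F}"
proof (intro equalityI subsetI)
  fix F assume F: "F \<in> facets (link \<Gamma> T)"
  have "H = F \<union> T" if "H \<in> \<Gamma>" "F \<union> T \<subseteq> H" for H
  proof -
    have "T \<union> H = H" using that by blast
    then have "H - T \<in> link \<Gamma> T" using that by (auto simp: link_def Un_commute)
    moreover have "F \<subseteq> H - T" using F that by (auto simp: facets_def link_def)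
    ultimately have "H - T = F" using F by (auto simp: facets_def)
    then show ?thesis using that by blast
  qed
  then have "F \<union> T \<in> {F \<in> facets \<Gamma>. T \<subseteq> F}" using F by (auto simp: facets_def link_def)
  moreover have "F = F \<union> T - T" using F by (auto simp: facets_def link_def)
  ultimately show "F \<in> (\<lambda>F. F - T) ` {F \<in> facets \<Gamma>. T \<subseteq> F}" by blast
next
  fix F assume "F \<in> (\<lambda>F. F - T) ` {F \<in> facets \<Gamma>. T \<subseteq> F}"
  then obtain H where H: "H \<in> facets \<Gamma>" "T \<subseteq> H" "F = H - T" by blast
  then have "F \<union> T = H" by blast
  then have "F \<in> link \<Gamma> T" using H by (auto simp: link_def facets_def)
  moreover have "F' = F" if "F' \<in> link \<Gamma> T" "F \<subseteq> F'" for F'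
  proof -
    have "H \<subseteq> F' \<union> T" using that H by blast
    then have "F' \<union> T = H" using that H by (auto simp: link_def facets_def)
    then show ?thesis using that H by (auto simp: link_def)
  qed
  ultimately show "F \<in> facets (link \<Gamma> T)" by (auto simp: facets_def)
qed

text \<open>Attachability depends only on the differences \<open>F - G\<close>, and these are
  unchanged when a set \<open>T\<close> contained in every \<open>G\<close> is removed.\<close>

lemma attachable_Diff_iff:
  assumes "\<forall>G\<in>\<F>. T \<subseteq> G"
  shows "attachable k ((\<lambda>F. F - T) ` \<F>) (F - T) \<longleftrightarrow> attachable k \<F> F"
proof -
  have diff: "F - T - (G - T) = F - G" if "G \<in> \<F>" for G using assms that by blast
  then have "(-) (F - T) ` (\<lambda>F. F - T) ` \<F> = (-) F ` \<F>" by (auto simp: image_image)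
  then show ?thesis by (simp add: attachable_def diff)
qed

lemma shelling_map_Diff_iff:
  assumes "\<forall>G\<in>\<F> \<union> set Fs. T \<subseteq> G"
  shows "shelling k ((\<lambda>F. F - T) ` \<F>) (map (\<lambda>F. F - T) Fs) \<longleftrightarrow> shelling k \<F> Fs"
  using assms
proof (induction Fs arbitrary: \<F>)
  case (Cons F Fs)
  then show ?case
    using Cons.IH[of "insert F \<F>"] attachable_Diff_iff[of \<F> T k F] by auto
qed simp

text \<open>Expresses shellability of a link by lists of facets of \<open>\<Gamma>\<close> itself,
  so that shellings of different links can be compared and concatenated.\<close>

lemma k_shellable_link_iff:
  assumes fin: "\<And>F. F \<in> \<Gamma> \<Longrightarrow> finite F"
  shows "k_shellable k (link \<Gamma> T) \<longleftrightarrow> 1 \<le> k \<and>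
    (\<exists>Fs. distinct Fs \<and> set Fs = {F \<in> facets \<Gamma>. T \<subseteq> F} \<and> shelling k {} Fs)"
proof -
  let ?star = "{F \<in> facets \<Gamma>. T \<subseteq> F}"
  have inj: "inj_on (\<lambda>F. F - T) ?star" by (rule inj_onI) blast
  have "(\<exists>Gs. distinct Gs \<and> set Gs = facets (link \<Gamma> T) \<and> shelling k {} Gs) \<longleftrightarrow>
    (\<exists>Fs. distinct Fs \<and> set Fs = ?star \<and> shelling k {} Fs)" (is "?L \<longleftrightarrow> ?R")
  proof
    assume ?L
    then obtain Gs where Gs: "distinct Gs" "set Gs = (\<lambda>F. F - T) ` ?star" "shelling k {} Gs"
      unfolding facets_link by blast
    define Fs where "Fs = map (\<lambda>G. G \<union> T) Gs"
    have "(\<lambda>F. F - T \<union> T) ` ?star = (\<lambda>F. F) ` ?star" by (rule image_cong) auto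
    then have setFs: "set Fs = ?star" by (simp add: Fs_def Gs(2) image_image)
    have Gs_eq: "Gs = map (\<lambda>F. F - T) Fs"
    proof -
      have "map (\<lambda>G. G \<union> T - T) Gs = map (\<lambda>G. G) Gs"
        by (rule map_cong) (auto simp: Gs(2))
      then show ?thesis by (simp add: Fs_def o_def)
    qed
    have "distinct Fs" using Gs(1) Gs_eq by (simp add: distinct_map)
    moreover have "shelling k {} Fs"
      using Gs(3) shelling_map_Diff_iff[of "{}" Fs T k] setFs by (auto simp: Gs_eq)
    ultimately show ?R using setFs by blast
  next
    assume ?R
    then obtain Fs where Fs: "distinct Fs" "set Fs = ?star" "shelling k {} Fs" by blast
    have "shelling k {} (map (\<lambda>F. F - T) Fs)"
      using Fs shelling_map_Diff_iff[of "{}" Fs T k] by auto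
    moreover have "distinct (map (\<lambda>F. F - T) Fs)" using Fs inj by (simp add: distinct_map)
    ultimately show ?L
      unfolding facets_link using Fs(2) by (metis list.set_map)
  qed
  moreover have "finite F" if "F \<in> link \<Gamma> T" for F
    using fin[of "F \<union> T"] that by (auto simp: link_def)
  ultimately show ?thesis by (simp add: k_shellable_iff_shelling)
qed

section \<open>Restricting a shelling to the facets containing a face\<close>

text \<open>Keep the members of \<open>\<B>\<close> that avoid \<open>T\<close>. Since
  \<open>T \<subseteq> F\<close>, such a member \<open>F - G\<close> forces
  \<open>T \<subseteq> G\<close>; conversely, any member below \<open>F - G\<close> with
  \<open>T \<subseteq> G\<close> avoids \<open>T\<close> and so is kept.\<close>

lemma attachable_star:
  assumes "attachable k \<F> F" "T \<subseteq> F"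
  shows "attachable k {G \<in> \<F>. T \<subseteq> G} F"
proof -
  obtain \<B> where \<B>: "\<B> \<subseteq> (-) F ` \<F>" "\<forall>B\<in>\<B>. card B = k" "pairwise disjnt \<B>"
    "\<forall>G\<in>\<F>. \<exists>B\<in>\<B>. B \<subseteq> F - G"
    using assms(1) unfolding attachable_def by blast
  let ?\<B> = "{B \<in> \<B>. B \<inter> T = {}}"
  have "?\<B> \<subseteq> (-) F ` {G \<in> \<F>. T \<subseteq> G}"
  proof
    fix B assume B: "B \<in> ?\<B>"
    then obtain G where "G \<in> \<F>" "B = F - G" using \<B>(1) by blast
    moreover from this have "T \<subseteq> G" using B assms(2) by blast
    ultimately show "B \<in> (-) F ` {G \<in> \<F>. T \<subseteq> G}" by simp
  qed
  moreover have "pairwise disjnt ?\<B>" using \<B>(3) by (rule pairwise_subset) auto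
  moreover have "\<exists>B\<in>?\<B>. B \<subseteq> F - G" if G: "G \<in> {G \<in> \<F>. T \<subseteq> G}" for G
  proof -
    obtain B where "B \<in> \<B>" "B \<subseteq> F - G" using \<B>(4) G by blast
    then show ?thesis using G by blast
  qed
  ultimately show ?thesis
    unfolding attachable_def using \<B>(2) by (intro exI[of _ ?\<B>]) simp
qed

lemma shelling_star:
  "shelling k \<F> Fs \<Longrightarrow> shelling k {G \<in> \<F>. T \<subseteq> G} (filter ((\<subseteq>) T) Fs)"
proof (induction Fs arbitrary: \<F>)
  case (Cons F Fs)
  then have "shelling k {G \<in> insert F \<F>. T \<subseteq> G} (filter ((\<subseteq>) T) Fs)"
    by (metis shelling.simps(2))
  \<comment> \<open>A facet dropped by the filter also leaves the accumulated star unchanged, so the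
    induction hypothesis fits both cases.\<close>
  moreover have "{G \<in> insert F \<F>. T \<subseteq> G} =
    (if T \<subseteq> F then insert F {G \<in> \<F>. T \<subseteq> G} else {G \<in> \<F>. T \<subseteq> G})" by auto
  ultimately have "shelling k (if T \<subseteq> F then insert F {G \<in> \<F>. T \<subseteq> G} else {G \<in> \<F>. T \<subseteq> G})
    (filter ((\<subseteq>) T) Fs)" by (simp only:)
  then show ?case
    using Cons.prems attachable_star[of k \<F> F T] by (cases "T \<subseteq> F") simp_all
qed simp

lemma k_shellable_link:
  assumes "\<And>F. F \<in> \<Gamma> \<Longrightarrow> finite F" and "k_shellable k \<Gamma>"
  shows "k_shellable k (link \<Gamma> T)"
proof -
  obtain Fs where "1 \<le> k" "distinct Fs" "set Fs = facets \<Gamma>" "shelling k {} Fs"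
    using assms by (auto simp: k_shellable_iff_shelling)
  moreover from this have "shelling k {} (filter ((\<subseteq>) T) Fs)"
    using shelling_star[of k "{}" Fs T] by simp
  moreover have "set (filter ((\<subseteq>) T) Fs) = {F \<in> facets \<Gamma>. T \<subseteq> F}"
    using \<open>set Fs = facets \<Gamma>\<close> by auto
  moreover have "distinct (filter ((\<subseteq>) T) Fs)"
    using \<open>distinct Fs\<close> by (rule distinct_filter)
  ultimately have "\<exists>Gs. distinct Gs \<and> set Gs = {F \<in> facets \<Gamma>. T \<subseteq> F} \<and> shelling k {} Gs"
    by (intro exI conjI)
  then show ?thesis
    using \<open>1 \<le> k\<close> by (simp add: k_shellable_link_iff[OF assms(1)])
qed

section \<open>Gluing shellings of stars\<close>

text \<open>Add \<open>T\<close> to \<open>\<B>\<close>. It is disjoint from the old members, each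
  of which is \<open>F - G\<close> with \<open>T \<subseteq> G\<close>; it lies below
  \<open>F - H\<close> for each \<open>H\<close> in \<open>\<H>\<close>; and the last assumption
  realises it as one of these differences.\<close>

lemma attachable_Un:
  assumes "attachable k \<F> F" "\<forall>G\<in>\<F>. T \<subseteq> G" "T \<subseteq> F" "card T = k"
    and "\<forall>H\<in>\<H>. T \<inter> H = {}" "\<exists>H\<in>\<H>. F - H = T"
  shows "attachable k (\<H> \<union> \<F>) F"
proof -
  obtain \<B> where \<B>: "\<B> \<subseteq> (-) F ` \<F>" "\<forall>B\<in>\<B>. card B = k" "pairwise disjnt \<B>"
    "\<forall>G\<in>\<F>. \<exists>B\<in>\<B>. B \<subseteq> F - G"
    using assms(1) unfolding attachable_def by blast
  have "disjnt T B" if "B \<in> \<B>" for B using \<B>(1) assms(2) that by (auto simp: disjnt_def)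
  then have "pairwise disjnt (insert T \<B>)"
    using \<B>(3) by (auto simp: pairwise_insert disjnt_sym)
  moreover have "insert T \<B> \<subseteq> (-) F ` (\<H> \<union> \<F>)" using \<B>(1) assms(6) by blast
  moreover have "\<forall>G\<in>\<H> \<union> \<F>. \<exists>B\<in>insert T \<B>. B \<subseteq> F - G"
  proof
    fix G assume "G \<in> \<H> \<union> \<F>"
    then show "\<exists>B\<in>insert T \<B>. B \<subseteq> F - G"
    proof
      assume "G \<in> \<H>"
      then have "T \<subseteq> F - G" using assms(3,5) by blast
      then show ?thesis by simp
    qed (use \<B>(4) in simp)
  qed
  ultimately show ?thesis
    unfolding attachable_def using \<B>(2) assms(4) by (intro exI[of _ "insert T \<B>"]) simp
qed

text \<open>\<open>\<H>\<close> stands for the earlier blocks and stays fixed, while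
  \<open>\<F>\<close> grows with the facets of the current block.\<close>

lemma shelling_Un:
  assumes "shelling k \<F> Fs" "\<forall>G\<in>\<F> \<union> set Fs. T \<subseteq> G" "card T = k"
    and "\<forall>H\<in>\<H>. T \<inter> H = {}" "\<forall>F\<in>set Fs. \<exists>H\<in>\<H>. F - H = T"
  shows "shelling k (\<H> \<union> \<F>) Fs"
  using assms
proof (induction Fs arbitrary: \<F>)
  case (Cons F Fs)
  have "attachable k (\<H> \<union> \<F>) F" using Cons.prems by (intro attachable_Un[of k \<F> F T]) auto
  moreover have "shelling k (\<H> \<union> insert F \<F>) Fs" using Cons.prems by (intro Cons.IH) auto
  ultimately show ?case by simp
qed simp

lemma shelling_concat:
  assumes "distinct Ts" "\<forall>T\<in>set Ts. card T = k \<and> shelling k {} (L T) \<and> (\<forall>F\<in>set (L T). T \<subseteq> F)"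
    and "\<forall>T\<in>set Ts. \<forall>H\<in>\<H>. T \<inter> H = {}"
    and "\<forall>T\<in>set Ts. \<forall>U\<in>set Ts. T \<noteq> U \<longrightarrow> (\<forall>H\<in>set (L U). T \<inter> H = {})"
    and "\<forall>T\<in>set Ts. \<forall>F\<in>set (L T). \<exists>H\<in>\<H>. F - H = T"
  shows "shelling k \<H> (concat (map L Ts))"
  using assms
proof (induction Ts arbitrary: \<H>)
  case (Cons T Ts)
  \<comment> \<open>The block of \<open>T\<close> starts with no facets of its own, whence the empty
    second set.\<close>
  have "shelling k (\<H> \<union> {}) (L T)" using Cons.prems by (intro shelling_Un[where T=T]) auto
  \<comment> \<open>The finished block joins \<open>\<H>\<close>: later \<open>U\<close> are
    disjoint from its facets by the cross-block assumption, and the witnesses with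
    \<open>F - H = U\<close> remain available.\<close>
  moreover have "shelling k (\<H> \<union> set (L T)) (concat (map L Ts))"
  proof (rule Cons.IH)
    show "\<forall>U\<in>set Ts. \<forall>H\<in>\<H> \<union> set (L T). U \<inter> H = {}"
      using Cons.prems(1,3,4) by (metis Un_iff distinct.simps(2) list.set_intros)
    show "\<forall>U\<in>set Ts. \<forall>F\<in>set (L U). \<exists>H\<in>\<H> \<union> set (L T). F - H = U"
      using Cons.prems(5) by (meson UnI1 list.set_intros(2))
  qed (use Cons.prems in auto)
  ultimately show ?case by (simp add: shelling_append)
qed simp

text \<open>The facets containing \<open>S\<close> come first, because \<open>exchange\<close>
  supplies all its witnesses there. The order of the remaining blocks is arbitrary.\<close>

lemma k_shellable_of_links:
  assumes fin: "\<And>F. F \<in> \<Gamma> \<Longrightarrow> finite F" and P: "finite P" "S \<in> P" "\<forall>T\<in>P. card T = k \<and> T \<noteq> {}"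
    and links: "\<forall>T\<in>P. k_shellable k (link \<Gamma> T)"
    and ex: "\<forall>F\<in>facets \<Gamma>. \<exists>T\<in>P. T \<subseteq> F"
    and disj: "\<And>F T U. F \<in> facets \<Gamma> \<Longrightarrow> T \<in> P \<Longrightarrow> U \<in> P \<Longrightarrow> T \<noteq> U \<Longrightarrow> U \<subseteq> F \<Longrightarrow> T \<inter> F = {}"
    and exchange: "\<And>F T. F \<in> facets \<Gamma> \<Longrightarrow> T \<in> P \<Longrightarrow> T \<noteq> S \<Longrightarrow> T \<subseteq> F \<Longrightarrow>
       \<exists>H\<in>facets \<Gamma>. S \<subseteq> H \<and> F - H = T"
  shows "k_shellable k \<Gamma>"
proof -
  have "\<forall>T\<in>P. \<exists>Fs. distinct Fs \<and> set Fs = {F \<in> facets \<Gamma>. T \<subseteq> F} \<and> shelling k {} Fs"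
    using links by (simp add: k_shellable_link_iff fin)
  then obtain L where L: "\<And>T. T \<in> P \<Longrightarrow> distinct (L T)"
    "\<And>T. T \<in> P \<Longrightarrow> set (L T) = {F \<in> facets \<Gamma>. T \<subseteq> F}" "\<And>T. T \<in> P \<Longrightarrow> shelling k {} (L T)"
    by metis
  obtain Ts where Ts: "set Ts = P - {S}" "distinct Ts"
    using finite_distinct_list[of "P - {S}"] P(1) by auto
  have "shelling k (set (L S)) (concat (map L Ts))"
  proof (rule shelling_concat)
    show "\<forall>T\<in>set Ts. \<forall>H\<in>set (L S). T \<inter> H = {}"
      using Ts L P(2) disj[of _ _ S] by auto
    show "\<forall>T\<in>set Ts. \<forall>U\<in>set Ts. T \<noteq> U \<longrightarrow> (\<forall>H\<in>set (L U). T \<inter> H = {})"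
    proof (intro ballI impI)
      fix T U H assume "T \<in> set Ts" "U \<in> set Ts" "T \<noteq> U" "H \<in> set (L U)"
      then show "T \<inter> H = {}" using Ts L(2)[of U] disj[of H T U] by simp
    qed
    show "\<forall>T\<in>set Ts. \<forall>F\<in>set (L T). \<exists>H\<in>set (L S). F - H = T"
    proof (intro ballI)
      fix T F assume "T \<in> set Ts" "F \<in> set (L T)"
      then have "\<exists>H\<in>facets \<Gamma>. S \<subseteq> H \<and> F - H = T"
        using Ts L(2)[of T] by (intro exchange) auto
      then show "\<exists>H\<in>set (L S). F - H = T" using L(2)[OF P(2)] by blast
    qed
    show "\<forall>T\<in>set Ts. card T = k \<and> shelling k {} (L T) \<and> (\<forall>F\<in>set (L T). T \<subseteq> F)"
      using P(3) by (simp add: Ts(1) L(2,3))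
  qed (rule Ts(2))
  then have "shelling k {} (concat (map L (S # Ts)))"
    using L(3)[OF P(2)] by (simp add: shelling_append)
  moreover have "set (concat (map L (S # Ts))) = facets \<Gamma>"
  proof -
    have "set (concat (map L (S # Ts))) = (\<Union>T\<in>P. set (L T))" using Ts(1) P(2) by auto
    also have "\<dots> = (\<Union>T\<in>P. {F \<in> facets \<Gamma>. T \<subseteq> F})" using L(2) by simp
    also have "\<dots> = facets \<Gamma>" using ex by blast
    finally show ?thesis .
  qed
  moreover have "distinct (concat (map L (S # Ts)))"
  proof -
    \<comment> \<open>A facet containing both \<open>T\<close> and \<open>U\<close> would be
      disjoint from \<open>T\<close> by \<open>disj\<close>, although \<open>T\<close> is
      nonempty.\<close>
    have sep: "set (L T) \<inter> set (L U) = {}" if "T \<in> P" "U \<in> P" "T \<noteq> U" for T U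
    proof -
      have "\<not> T \<subseteq> F" if "F \<in> facets \<Gamma>" "U \<subseteq> F" for F
        using disj[OF that(1) \<open>T \<in> P\<close> \<open>U \<in> P\<close> \<open>T \<noteq> U\<close> that(2)] P(3) \<open>T \<in> P\<close> by blast
      then show ?thesis using L(2)[OF \<open>T \<in> P\<close>] L(2)[OF \<open>U \<in> P\<close>] by blast
    qed
    have "distinct (concat (map L Us))" if "distinct Us" "set Us \<subseteq> P" for Us
      using that
    proof (induction Us)
      case (Cons U Us)
      have "set (L U) \<inter> set (L T) = {}" if "T \<in> set Us" for T
        using Cons.prems that by (intro sep) auto
      then have "set (L U) \<inter> set (concat (map L Us)) = {}" by auto
      then show ?case using Cons.IH Cons.prems L(1)[of U] by simp
    qed simp
    moreover have "distinct (S # Ts)" "set (S # Ts) \<subseteq> P" using Ts P(2) by auto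
    ultimately show ?thesis by blast
  qed
  moreover have "1 \<le> k" using links P(2) by (auto simp: k_shellable_def)
  ultimately have "1 \<le> k \<and> (\<exists>Fs. distinct Fs \<and> set Fs = facets \<Gamma> \<and> shelling k {} Fs)"
    by (intro conjI exI)
  then show ?thesis by (simp add: k_shellable_iff_shelling[OF fin])
qed

section \<open>Independence complexes\<close>

lemma subset_facet:
  assumes "finite \<Gamma>" "\<sigma> \<in> \<Gamma>"
  obtains F where "F \<in> facets \<Gamma>" "\<sigma> \<subseteq> F"
proof -
  obtain F where "F \<in> \<Gamma>" "\<sigma> \<subseteq> F" "\<forall>G\<in>\<Gamma>. F \<subseteq> G \<longrightarrow> F = G"
    using finite_has_maximal2[OF assms] by blast
  then show ?thesis by (intro that[of F]) (auto simp: facets_def)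
qed

text \<open>A vertex survives the deletion iff it is neither in \<open>T\<close> nor adjacent to a
  vertex of \<open>T\<close>, which is exactly when an independent \<open>T\<close> can be enlarged
  by it.\<close>

lemma indep_complex_delete_closed_nbhd:
  assumes "simple_graph V E" "independent V E T"
  shows "indep_complex (V - closed_nbhd_set V E T) (restrict_edges E (V - closed_nbhd_set V E T))
    = link (indep_complex V E) T"
proof -
  let ?N = "closed_nbhd_set V E T"
  have sym: "\<And>x y. E x y \<Longrightarrow> E y x" and T: "T \<subseteq> V" "\<And>x y. x \<in> T \<Longrightarrow> y \<in> T \<Longrightarrow> \<not> E x y"
    using assms by (auto simp: simple_graph_def independent_def)
  have N: "x \<in> ?N \<longleftrightarrow> x \<in> T \<or> (\<exists>t\<in>T. E t x)" if "x \<in> V" for x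
    using that by (auto simp: closed_nbhd_set_def closed_nbhd_def nbhd_def)
  have "independent (V - ?N) (restrict_edges E (V - ?N)) F \<longleftrightarrow> F \<inter> T = {} \<and> independent V E (F \<union> T)"
    (is "?L \<longleftrightarrow> ?R") for F
  proof
    assume L: ?L
    then have F: "F \<subseteq> V - ?N" by (simp add: independent_def)
    have "\<not> E x y" if "x \<in> F" "y \<in> F" for x y
      using L F that by (auto simp: independent_def restrict_edges_def)
    moreover have "\<not> E x y" "\<not> E y x" "x \<noteq> y" if "x \<in> F" "y \<in> T" for x y
      using N[of x] F that sym by auto
    ultimately show ?R using F T unfolding independent_def by blast
  next
    assume R: ?R
    then have "x \<in> V - ?N" if "x \<in> F" for x
      using N[of x] that by (auto simp: independent_def)
    then show ?L using R by (auto simp: independent_def restrict_edges_def)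
  qed
  then show ?thesis by (simp add: indep_complex_def link_def)
qed

text \<open>A neighbour of \<open>y\<close> in \<open>F\<close> would be a neighbour of
  \<open>x\<close> in \<open>F\<close>; hence \<open>insert y F\<close> is independent, and
  maximality of \<open>F\<close> applies.\<close>

lemma facet_indep_complex_twins:
  assumes G: "simple_graph V E" and F: "F \<in> facets (indep_complex V E)"
    and xy: "x \<in> F" "y \<in> V" "nbhd V E x = nbhd V E y"
  shows "y \<in> F"
proof -
  have F': "F \<subseteq> V" "\<And>u v. u \<in> F \<Longrightarrow> v \<in> F \<Longrightarrow> \<not> E u v"
    using F by (auto simp: facets_def indep_complex_def independent_def)
  have sym: "\<And>u v. E u v \<Longrightarrow> E v u" and "\<not> E y y" using G by (auto simp: simple_graph_def)
  have "\<not> E y z" if "z \<in> F" for z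
  proof
    assume "E y z"
    then have "z \<in> nbhd V E y" using that F'(1) by (auto simp: nbhd_def)
    then have "z \<in> nbhd V E x" by (simp only: xy(3))
    then show False using F'(2)[OF xy(1) that] by (simp add: nbhd_def)
  qed
  then have "independent V E (insert y F)"
    using F' xy(2) sym \<open>\<not> E y y\<close> unfolding independent_def by blast
  then show ?thesis using F by (auto simp: facets_def indep_complex_def)
qed

section \<open>The parts around a k-simplicial set\<close>

theorem theorem4p7:
  fixes V :: "'a set" and E :: "'a \<Rightarrow> 'a \<Rightarrow> bool" and k :: nat
    and S :: "'a set" and P :: "'a set set"
  assumes "simple_graph V E"
    and "1 \<le> k"
    and "k_simplicial V E k S P"
    and "S \<in> P"
  shows "k_shellable_graph V E k \<longleftrightarrow>
           (\<forall>Si\<in>P. k_shellable_graph (V - closed_nbhd_set V E Si)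
                       (restrict_edges E (V - closed_nbhd_set V E Si)) k)"
proof -
  let ?\<Gamma> = "indep_complex V E"
  define W where "W = closed_nbhd_set V E S"
  have finV: "finite V" and sym: "\<And>x y. E x y \<Longrightarrow> E y x" and EV: "\<And>x y. E x y \<Longrightarrow> x \<in> V \<and> y \<in> V"
    using assms(1) by (simp_all add: simple_graph_def)
  have SV: "S \<subseteq> V" using assms(3) by (simp add: k_simplicial_def independent_def)
  have mp: "complete_multipartite W (restrict_edges E W) P"
    and cardP: "\<And>p. p \<in> P \<Longrightarrow> card p = k"
    and twins: "\<And>p x y. p \<in> P \<Longrightarrow> x \<in> p \<Longrightarrow> y \<in> p \<Longrightarrow> nbhd V E x = nbhd V E y"
    using assms(3) unfolding k_simplicial_def W_def[symmetric] by blast+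
  have W: "\<Union>P = W" "{} \<notin> P" and Pdisj: "\<And>p q. p \<in> P \<Longrightarrow> q \<in> P \<Longrightarrow> p \<noteq> q \<Longrightarrow> p \<inter> q = {}"
    and adj: "\<And>x y. x \<in> W \<Longrightarrow> y \<in> W \<Longrightarrow> E x y \<longleftrightarrow> \<not> (\<exists>p\<in>P. x \<in> p \<and> y \<in> p)"
    using mp by (simp_all add: complete_multipartite_def restrict_edges_def)
  have WV: "W \<subseteq> V" using SV by (auto simp: W_def closed_nbhd_set_def closed_nbhd_def nbhd_def)
  have PW: "p \<subseteq> W" if "p \<in> P" for p using W(1) that by blast
  have nbW: "y \<in> W" if "x \<in> S" "E x y" for x y
    using that EV by (auto simp: W_def closed_nbhd_set_def closed_nbhd_def nbhd_def)
  have indP: "independent V E T" if "T \<in> P" for T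
    using that PW[OF that] WV adj unfolding independent_def by blast
  have cross: "E x y" if "x \<in> p" "y \<in> q" "p \<in> P" "q \<in> P" "p \<noteq> q" for x y p q
  proof -
    have "\<not> (\<exists>u\<in>P. x \<in> u \<and> y \<in> u)" using that Pdisj by blast
    then show ?thesis using adj PW that by blast
  qed
  have fin: "finite F" if "F \<in> ?\<Gamma>" for F
    using that finV by (auto simp: indep_complex_def independent_def intro: finite_subset)
  have fin\<Gamma>: "finite ?\<Gamma>"
    by (rule finite_subset[of _ "Pow V"]) (auto simp: indep_complex_def independent_def finV)
  have finP: "finite P"
    by (rule finite_subset[of _ "Pow V"]) (use PW WV finV in auto)
  have facetD: "F \<subseteq> V" "\<And>x y. x \<in> F \<Longrightarrow> y \<in> F \<Longrightarrow> \<not> E x y" if "F \<in> facets ?\<Gamma>" for F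
    using that by (auto simp: facets_def indep_complex_def independent_def)
  \<comment> \<open>Some vertex \<open>u\<close> of \<open>U\<close> lies in \<open>F\<close>, and
    every vertex of the other part \<open>T\<close> is adjacent to it.\<close>
  have disj: "T \<inter> F = {}" if "F \<in> facets ?\<Gamma>" "T \<in> P" "U \<in> P" "T \<noteq> U" "U \<subseteq> F" for F T U
  proof -
    obtain u where "u \<in> U" using W(2) \<open>U \<in> P\<close> by (metis ex_in_conv)
    then show ?thesis using that cross[of _ T u U] facetD(2)[of F] by blast
  qed
  have ex: "\<exists>T\<in>P. T \<subseteq> F" if F: "F \<in> facets ?\<Gamma>" for F
  proof -
    \<comment> \<open>Otherwise a vertex of \<open>S\<close>, whose neighbours all lie in
      \<open>W\<close>, could be added to \<open>F\<close>.\<close>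
    have "\<exists>y\<in>W. y \<in> F"
    proof (rule ccontr)
      assume none: "\<not> (\<exists>y\<in>W. y \<in> F)"
      obtain x where x: "x \<in> S" using W(2) assms(4) by (metis ex_in_conv)
      have "independent V E (insert x F)"
        using none nbW[OF x] x SV sym facetD[OF F] assms(1)
        unfolding independent_def simple_graph_def by blast
      then have "insert x F = F" using F by (auto simp: facets_def indep_complex_def)
      then show False using none x PW[OF assms(4)] by blast
    qed
    then obtain y T where yT: "y \<in> F" "T \<in> P" "y \<in> T" using W(1) by blast
    \<comment> \<open>One vertex of \<open>T\<close> in \<open>F\<close> draws in the whole part,
      since vertices of a part have the same neighbours.\<close>
    have "x \<in> F" if "x \<in> T" for x
    proof (rule facet_indep_complex_twins[OF assms(1) F \<open>y \<in> F\<close>])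
      show "x \<in> V" using that PW[OF \<open>T \<in> P\<close>] WV by blast
      show "nbhd V E y = nbhd V E x" using yT(2,3) that by (rule twins)
    qed
    then show ?thesis using yT(2) by blast
  qed
  have exchange: "\<exists>H\<in>facets ?\<Gamma>. S \<subseteq> H \<and> F - H = T"
    if F: "F \<in> facets ?\<Gamma>" and T: "T \<in> P" "T \<noteq> S" "T \<subseteq> F" for F T
  proof -
    \<comment> \<open>A neighbour \<open>y\<close> of \<open>S\<close> would lie in a part
      \<open>U\<close>. As \<open>y\<close> is outside \<open>T\<close>, this is a part other than
      \<open>T\<close>, and the facet \<open>F\<close> containing \<open>T\<close> misses
      it.\<close>
    have "\<not> E x y" if x: "x \<in> S" and y: "y \<in> F - T" for x y
    proof
      assume "E x y"
      then obtain U where U: "U \<in> P" "y \<in> U" using nbW[OF x] W(1) by blast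
      then have "U \<noteq> T" using y by blast
      then show False using disj[OF F U(1) T(1) _ T(3)] U y by blast
    qed
    then have "independent V E ((F - T) \<union> S)"
      using facetD[OF F] indP[OF assms(4)] sym unfolding independent_def by blast
    then have "(F - T) \<union> S \<in> ?\<Gamma>" by (simp add: indep_complex_def)
    then obtain H where H: "H \<in> facets ?\<Gamma>" "(F - T) \<union> S \<subseteq> H" by (rule subset_facet[OF fin\<Gamma>])
    \<comment> \<open>Extending to a facet cannot bring \<open>T\<close> back, because
      \<open>H\<close> contains \<open>S\<close>. Together with \<open>F - T \<subseteq> H\<close>
      this makes \<open>F - H\<close> exactly \<open>T\<close>.\<close>
    then have "T \<inter> H = {}" using disj[OF H(1) T(1) assms(4) T(2)] by blast
    then show ?thesis using H T by blast
  qed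
  have links: "k_shellable_graph (V - closed_nbhd_set V E T)
      (restrict_edges E (V - closed_nbhd_set V E T)) k \<longleftrightarrow> k_shellable k (link ?\<Gamma> T)"
    if "T \<in> P" for T
    by (simp add: k_shellable_graph_def indep_complex_delete_closed_nbhd assms(1) indP[OF that])
  show ?thesis
  proof
    assume "k_shellable_graph V E k"
    then have "k_shellable k (link ?\<Gamma> T)" for T
      by (intro k_shellable_link fin) (simp_all add: k_shellable_graph_def)
    then show "\<forall>Si\<in>P. k_shellable_graph (V - closed_nbhd_set V E Si)
                       (restrict_edges E (V - closed_nbhd_set V E Si)) k"
      by (simp add: links)
  next
    assume "\<forall>Si\<in>P. k_shellable_graph (V - closed_nbhd_set V E Si)
                       (restrict_edges E (V - closed_nbhd_set V E Si)) k"
    then have shell: "\<forall>T\<in>P. k_shellable k (link ?\<Gamma> T)" by (simp add: links)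
    have parts: "\<forall>T\<in>P. card T = k \<and> T \<noteq> {}" using cardP W(2) by blast
    have cover: "\<forall>F\<in>facets ?\<Gamma>. \<exists>T\<in>P. T \<subseteq> F" using ex by (rule ballI)
    show "k_shellable_graph V E k"
      unfolding k_shellable_graph_def
      by (rule k_shellable_of_links[OF fin finP assms(4) parts shell cover disj exchange])
  qed
qed

end
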